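(* Let $-\infty\le a_-<0<a_+\le\infty$ and $I:=\mathbb R\cap[a_-,a_+]$. Take any function $\mathsf r\colon[-\infty,\infty]\to[-\infty,\infty]$. Then the following two conditions are equivalent to each other: (I) there exists a non-atomic zero-mean probability measure $\mu$ on $\mathcal B(\mathbb R)$ such that $\operatorname{supp}\mu=I$ and $\mathsf r_\mu=\mathsf r$; (II) $\mathsf r(0)=0$, and the following conditions hold: - $\mathsf r$ is strictly decreasing on $[a_-,a_+]$; - $\mathsf r$ is continuous on $[-\infty,\infty]$; - $\mathsf r=a_+$ on $[-\infty,a_-]$ and $\mathsf r=a_-$ on $[a_+,\infty]$; - $\mathsf r(\mathsf r(x))=x$ for all $x\in[a_-,a_+]$.
   Context: $\mathcal B(\mathbb R)$ is the Borel $\sigma$-algebra; $\operatorname{supp}\mu$ is the set of all $x\in\mathbb R$ each of whose open neighborhoods has positive $\mu$-measure. A probability measure $\mu$ on $\mathcal B(\mathbb R)$ is zero-mean if $\int|x|\,\mu(dx)<\infty$ and $\int x\,\mu(dx)=0$. Continuity of $[-\infty,\infty]$-valued functions is with respect to the usual topology of the extended line. For a non-atomic zero-mean probability measure $\mu$ (extended to $[-\infty,\infty]$ by $\mu(\{\pm\infty\})=0$), define $G\colon[-\infty,\infty]\to[0,\infty)$ by $G(x)=\int_{(0,x]}z\,\mu(dz)$ for $x\in[0,\infty]$ and $G(x)=\int_{[x,0)}(-z)\,\mu(dz)$ for $x\in[-\infty,0]$; let $x_{+}(h)=\inf\{x\in[0,\infty]\colon G(x)\ge h\}$ and $x_{-}(h)=\sup\{x\in[-\infty,0]\colon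 G(x)\ge h\}$ (with $\inf\emptyset=\infty$, $\sup\emptyset=-\infty$); the reciprocating function $\mathsf r_\mu\colon[-\infty,\infty]\to[-\infty,\infty]$ of $\mu$ is $\mathsf r_\mu(x)=x_-(G(x))$ for $x\in[0,\infty]$ and $\mathsf r_\mu(x)=x_+(G(x))$ for $x\in[-\infty,0]$. *)

theory Defs
  imports "HOL-Probability.Probability"
begin

(* An atom is a measurable set of positive measure with no measurable subset of strictly
   intermediate measure; for Borel probability measures on the line, non-atomicity in this
   sense amounts to all singletons being null. *)
definition atom_of :: "'a measure \<Rightarrow> 'a set \<Rightarrow> bool" where
  "atom_of M A \<longleftrightarrow> A \<in> sets M \<and> emeasure M A > 0 \<and>
     (\<forall>B\<in>sets M. B \<subseteq> A \<longrightarrow> emeasure M B = 0 \<or> emeasure M B = emeasure M A)"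

definition nonatomic :: "'a measure \<Rightarrow> bool" where
  "nonatomic M \<longleftrightarrow> (\<nexists>A. atom_of M A)"

definition measure_support :: "'a::topological_space measure \<Rightarrow> 'a set" where
  "measure_support M = {x. \<forall>U. open U \<longrightarrow> x \<in> U \<longrightarrow> emeasure M U > 0}"

definition zero_mean :: "real measure \<Rightarrow> bool" where
  "zero_mean M \<longleftrightarrow> integrable M (\<lambda>x. x) \<and> (LINT x|M. x) = 0"

(* Since the extension of the measure to the extended line gives no mass to the two infinite
   points, the integrals over (0,x] and [x,0) are taken over the real points of these intervals. *)
definition G_fun :: "real measure \<Rightarrow> ereal \<Rightarrow> real" where
  "G_fun M x = (if x \<ge> 0 then (LINT z:{z. 0 < z \<and> ereal z \<le> x}|M. z)
                else (LINT z:{z. x \<le> ereal z \<and> z < 0}|M. - z))"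

(* In ereal, Inf {} = \<infinity> and Sup {} = -\<infinity>. *)
definition x_plus :: "real measure \<Rightarrow> real \<Rightarrow> ereal" where
  "x_plus M h = Inf {x. 0 \<le> x \<and> G_fun M x \<ge> h}"

definition x_minus :: "real measure \<Rightarrow> real \<Rightarrow> ereal" where
  "x_minus M h = Sup {x. x \<le> 0 \<and> G_fun M x \<ge> h}"

(* The two defining clauses of G_fun, and likewise of recip_fun, overlap at x = 0, where both
   give 0. *)
definition recip_fun :: "real measure \<Rightarrow> ereal \<Rightarrow> ereal" where
  "recip_fun M x = (if x \<ge> 0 then x_minus M (G_fun M x) else x_plus M (G_fun M x))"

lemma G_fun_0: "G_fun M 0 = 0"
proof -
  have "{z::real. 0 < z \<and> z \<le> 0} = {}" by auto
  then show ?thesis by (simp add: G_fun_def set_lebesgue_integral_def)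
qed

lemma G_fun_nonpos: "x \<le> 0 \<Longrightarrow> G_fun M x = (LINT z:{z. x \<le> ereal z \<and> z < 0}|M. - z)"
proof (cases "x = 0")
  case True
  have "{z::real. 0 \<le> z \<and> z < 0} = {}" by auto
  with True show ?thesis by (simp add: G_fun_0 set_lebesgue_integral_def)
qed (simp add: G_fun_def)

lemma recip_fun_nonpos: "x \<le> 0 \<Longrightarrow> recip_fun M x = x_plus M (G_fun M x)"
proof (cases "x = 0")
  case True
  have "x_minus M 0 = 0" unfolding x_minus_def
    by (rule Sup_eqI) (auto simp: G_fun_0)
  moreover have "x_plus M 0 = 0" unfolding x_plus_def
    by (rule Inf_eqI) (auto simp: G_fun_0)
  ultimately show ?thesis using True by (simp add: recip_fun_def G_fun_0)
qed (simp add: recip_fun_def)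

end

theory Submission
  imports Defs
begin

text \<open>For a measure as in (I), \<open>G\<close> is continuous, strictly monotone on either side of \<open>0\<close> inside the
  interval and constant beyond its ends, and zero mean makes its two end values agree. So \<open>r x\<close> is
  the unique point on the other side of \<open>0\<close> with \<open>G (r x) = G x\<close>, and everything in (II) follows.

  Conversely, given \<open>r\<close>, choose \<open>t\<close> in \<open>(0, a\<^sub>+)\<close> with density proportional to the standard normal
  one, and then a point of the zero-mean two-point law on \<open>{r t, t}\<close>. The resulting mixture is
  centred. Each of its components contributes equally to the positive and the negative side, hence
  \<open>G (r x) = G x\<close>.\<close>

section \<open>Atoms and support of Borel measures; \<open>G_fun\<close> as a single
  integral\<close>

lemma null_singleton_if_nonatomic:
  fixes M :: "real measure"
  assumes "sets M = sets borel" and "nonatomic M"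
  shows "emeasure M {x} = 0"
proof (rule ccontr)
  assume "emeasure M {x} \<noteq> 0"
  then have "atom_of M {x}"
    using assms(1) by (auto simp: atom_of_def subset_singleton_iff zero_less_iff_neq_zero)
  with assms(2) show False by (auto simp: nonatomic_def)
qed

text \<open>An atom with null singletons could be halved: the distribution function of the measure
  restricted to it is continuous, so by the intermediate value theorem some ray cuts off exactly
  half of its mass.\<close>

lemma nonatomic_if_null_singletons:
  fixes M :: "real measure"
  assumes "finite_measure M" and sets_M: "sets M = sets borel" and null: "\<And>x. emeasure M {x} = 0"
  shows "nonatomic M"
  unfolding nonatomic_def
proof
  assume "\<exists>A. atom_of M A"
  then obtain A where A: "A \<in> sets M" "emeasure M A > 0"
    and dich: "\<And>B. B \<in> sets M \<Longrightarrow> B \<subseteq> A \<Longrightarrow> emeasure M B = 0 \<or> emeasure M B = emeasure M A"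
    unfolding atom_of_def by auto
  interpret finite_measure M by fact
  \<comment> \<open>A density, unlike a restricted space, keeps the Borel sets of the whole line, as
    the facts on \<open>cdf\<close> require.\<close>
  define N where "N = density M (indicator A)"
  have em_N: "emeasure N B = emeasure M (A \<inter> B)" if "B \<in> sets borel" for B
    using that A(1) sets_M
    by (simp add: N_def emeasure_density indicator_inter_arith[symmetric] del: indicator_inter_arith)
  then have meas_N: "measure N B = measure M (A \<inter> B)" if "B \<in> sets borel" for B
    using that by (simp add: measure_def)
  have space_M: "space M = UNIV"
    using sets_eq_imp_space_eq[OF sets_M] by simp
  have space_N: "space N = UNIV" by (simp add: N_def space_M)
  have "finite_measure N"
    by (rule finite_measureI) (use em_N[of UNIV] emeasure_finite in \<open>simp add: space_N\<close>)
  then interpret N: finite_borel_measure N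
    by (simp add: finite_borel_measure_def finite_borel_measure_axioms_def N_def sets_M)
  have "measure N {x} = 0" for x
    using null[of x] meas_N[of "{x}"] emeasure_mono[of "A \<inter> {x}" "{x}" M] sets_M
    by (simp add: measure_def)
  then have cont: "continuous_on UNIV (cdf N)"
    by (auto intro!: continuous_at_imp_continuous_on simp: N.isCont_cdf)
  define m where "m = measure M A"
  have "m > 0"
    using A(2) by (simp add: m_def emeasure_eq_measure)
  have "((\<lambda>x. cdf N x) \<longlongrightarrow> m) at_top"
    using N.cdf_lim_at_top meas_N[of UNIV] by (simp add: m_def space_N)
  then obtain b where b: "cdf N b > m / 2"
    using \<open>m > 0\<close> eventually_happens[OF order_tendstoD(1), of "cdf N" m at_top "m/2"] by auto
  obtain a where a: "cdf N a < m / 2"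
    using \<open>m > 0\<close> eventually_happens[OF order_tendstoD(2), OF N.cdf_lim_at_bot, of "m/2"] by auto
  have "a \<le> b"
    using a b N.cdf_nondecreasing[of b a] by linarith
  then obtain x where x: "cdf N x = m / 2"
    using IVT'[of "cdf N" a "m/2" b] a b continuous_on_subset[OF cont] by fastforce
  then have "measure M (A \<inter> {..x}) = m / 2"
    using meas_N by (simp add: cdf_def)
  moreover have "emeasure M (A \<inter> {..x}) = 0 \<or> emeasure M (A \<inter> {..x}) = emeasure M A"
    using A(1) by (intro dich) (auto simp: sets_M)
  ultimately show False
    using \<open>m > 0\<close> by (auto simp: measure_def m_def)
qed

text \<open>The complement is the union of all null open sets, which the Lindelof property reduces
  to a countable union.\<close>

lemma emeasure_Compl_support:
  fixes M :: "'a::second_countable_topology measure"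
  assumes sets_M: "sets M = sets borel"
  shows "emeasure M (- measure_support M) = 0"
proof -
  define \<F> where "\<F> = {U. open U \<and> emeasure M U = 0}"
  obtain \<F>' where \<F>': "\<F>' \<subseteq> \<F>" "countable \<F>'" "\<Union>\<F>' = \<Union>\<F>"
    by (rule Lindelof[of \<F>]) (auto simp: \<F>_def)
  have "- measure_support M = \<Union>\<F>"
    by (auto simp: \<F>_def measure_support_def zero_less_iff_neq_zero)
  moreover have "(\<Union>U\<in>\<F>'. U) \<in> null_sets M"
    using \<F>' by (intro null_sets_UN') (auto simp: \<F>_def sets_M null_sets_def)
  ultimately show ?thesis
    using \<F>' by auto
qed

text \<open>At most one of the disjuncts is satisfiable, according to the sign of \<open>x\<close>; this lets both clauses
  of \<^const>\<open>G_fun\<close> be treated at once.\<close>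

definition btw :: "ereal \<Rightarrow> real set" where
  "btw x = {z. 0 < z \<and> ereal z \<le> x \<or> z < 0 \<and> x \<le> ereal z}"

lemma btw_measurable [measurable]: "btw x \<in> sets borel"
  unfolding btw_def by measurable

text \<open>One nonnegative integrand on the whole line replaces the two set integrals, ready for
  dominated convergence and comparison.\<close>

lemma G_fun_eq: "G_fun M x = (LINT z|M. indicator (btw x) z * \<bar>z\<bar>)"
proof (cases "x \<ge> 0")
  case True
  then have "indicator (btw x) z * \<bar>z\<bar> = indicator {z. 0 < z \<and> ereal z \<le> x} z * z" for z
    by (auto simp: btw_def indicator_def dest: order_trans[of 0 x] simp flip: zero_ereal_def)
  with True show ?thesis
    by (simp add: G_fun_def set_lebesgue_integral_def)
next
  case False
  then have "indicator (btw x) z * \<bar>z\<bar> = indicator {z. x \<le> ereal z \<and> z < 0} z * - z" for z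
    using order_trans[of 0 "ereal z" x] by (auto simp: btw_def indicator_def)
  with False show ?thesis
    by (simp add: G_fun_def set_lebesgue_integral_def)
qed

section \<open>Necessity: continuity and strict monotonicity of \<open>G_fun\<close> for a measure
  as in (I)\<close>

locale centred_measure = prob_space M for M :: "real measure" +
  fixes am ap :: ereal
  assumes am_neg: "am < 0" and ap_pos: "0 < ap"
    and sets_M [measurable_cong]: "sets M = sets borel"
    and null_singleton: "\<And>x. emeasure M {x} = 0"
    and centred: "zero_mean M"
    and support: "measure_support M = {x. am \<le> ereal x \<and> ereal x \<le> ap}"
begin

lemma integrable_G: "integrable M (\<lambda>z. indicator (btw x) z * \<bar>z\<bar>)"
proof (rule Bochner_Integration.integrable_bound)
  show "integrable M (\<lambda>z. z)" using centred by (simp add: zero_mean_def)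
qed (auto simp: indicator_def)

lemma AE_neq: "AE z in M. z \<noteq> c"
  by (rule AE_I[of _ _ "{c}"]) (auto simp: null_singleton sets_M)

lemma AE_support: "AE z in M. am \<le> ereal z \<and> ereal z \<le> ap"
proof (rule AE_I[of _ _ "- measure_support M"])
  have "{x. am \<le> ereal x \<and> ereal x \<le> ap} \<in> sets borel" by measurable
  then show "- measure_support M \<in> sets M" by (auto simp: support sets_M)
qed (auto simp: support emeasure_Compl_support[OF sets_M, simplified support])

text \<open>Dominated convergence with bound |z|: the integrands converge at every z other than x,
  and that point is null.\<close>

lemma continuous_G: "continuous_on UNIV (G_fun M)"
proof (rule continuous_on_sequentiallyI)
  fix X :: "nat \<Rightarrow> ereal" and x :: ereal
  assume X: "X \<longlonglongrightarrow> x"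
  have "AE z in M. ereal z \<noteq> x"
  proof (cases x)
    case (real c)
    then show ?thesis using AE_neq[of c] by simp
  qed auto
  then have "AE z in M. (\<lambda>n. indicator (btw (X n)) z * \<bar>z\<bar>) \<longlonglongrightarrow> indicator (btw x) z * \<bar>z\<bar>"
  proof eventually_elim
    case (elim z)
    \<comment> \<open>If z < y, then z lies in \<open>btw y\<close> exactly when z > 0; if y < z,
      exactly when z < 0. So membership settles once \<open>X n\<close> is on the same side of z as
      x.\<close>
    have "\<forall>\<^sub>F n in sequentially. indicator (btw (X n)) z * \<bar>z\<bar> = indicator (btw x) z * \<bar>z\<bar>"
    proof (cases "ereal z < x")
      case True
      from order_tendstoD(1)[OF X True] show ?thesis
        by eventually_elim (use True in \<open>auto simp: btw_def indicator_def\<close>)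
    next
      case False
      with elim have "x < ereal z" by auto
      from order_tendstoD(2)[OF X this] show ?thesis
        by eventually_elim (use \<open>x < ereal z\<close> in \<open>auto simp: btw_def indicator_def\<close>)
    qed
    then show ?case by (rule tendsto_eventually)
  qed
  then show "(\<lambda>n. G_fun M (X n)) \<longlonglongrightarrow> G_fun M x"
    unfolding G_fun_eq
  proof (rule integral_dominated_convergence[where w = "\<lambda>z. \<bar>z\<bar>", rotated 3])
    show "integrable M (\<lambda>z. \<bar>z\<bar>)" using centred by (simp add: zero_mean_def)
  qed (auto simp: indicator_def)
qed

lemma G_cong_AE:
  assumes "AE z in M. z \<in> btw x \<longleftrightarrow> z \<in> btw y"
  shows "G_fun M x = G_fun M y"
  unfolding G_fun_eq
proof (rule integral_cong_AE)
  show "AE z in M. indicator (btw x) z * \<bar>z\<bar> = indicator (btw y) z * \<bar>z\<bar>"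
    using assms by eventually_elim (simp add: indicator_def)
qed measurable

text \<open>No mass lies beyond \<open>ap\<close>, so going past it changes \<open>btw\<close> by a
  null set.\<close>

lemma G_above:
  assumes "ap \<le> x"
  shows "G_fun M x = G_fun M ap"
  using AE_support
proof (intro G_cong_AE, eventually_elim)
  case (elim z)
  have "\<not> z < 0" if "ap \<le> ereal z"
    using ap_pos that by (auto dest: order_less_le_trans simp flip: zero_ereal_def)
  with elim assms show ?case by (auto simp: btw_def dest: order_trans)
qed

lemma G_below:
  assumes "x \<le> am"
  shows "G_fun M x = G_fun M am"
  using AE_support
proof (intro G_cong_AE, eventually_elim)
  case (elim z)
  have "\<not> z > 0" if "ereal z \<le> am"
    using am_neg that by (auto dest: order_le_less_trans simp flip: zero_ereal_def)
  with elim assms show ?case by (auto simp: btw_def dest: order_trans)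
qed

text \<open>The two integrands differ by the identity, whose integral is the mean, that is,
  0.\<close>

lemma G_infty: "G_fun M \<infinity> = G_fun M (- \<infinity>)"
proof -
  have "G_fun M \<infinity> - G_fun M (- \<infinity>) = (LINT z|M. indicator (btw \<infinity>) z * \<bar>z\<bar> - indicator (btw (- \<infinity>)) z * \<bar>z\<bar>)"
    unfolding G_fun_eq by (rule Bochner_Integration.integral_diff[symmetric]) (rule integrable_G)+
  also have "\<dots> = (LINT z|M. z)"
    by (rule Bochner_Integration.integral_cong) (auto simp: btw_def indicator_def)
  also have "\<dots> = 0" using centred by (simp add: zero_mean_def)
  finally show ?thesis by simp
qed

lemma G_ends: "G_fun M ap = G_fun M am"
  using G_infty G_above[of \<infinity>] G_below[of "- \<infinity>"] by simp

text \<open>With equal integrals the gap between the two sets would be null. But it contains an open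
  interval that meets the support.\<close>

lemma G_less:
  assumes sub: "btw x \<subseteq> btw y" "{z. u < ereal z \<and> ereal z < v} \<subseteq> btw y - btw x"
    and uv: "am \<le> u" "u < v" "v \<le> ap"
  shows "G_fun M x < G_fun M y"
proof -
  let ?f = "\<lambda>z. indicator (btw y) z * \<bar>z\<bar> - indicator (btw x) z * \<bar>z\<bar>"
  let ?U = "{z. u < ereal z \<and> ereal z < v}"
  have int: "integrable M ?f" by (intro Bochner_Integration.integrable_diff integrable_G)
  have nn: "0 \<le> ?f z" for z using sub by (auto simp: indicator_def)
  have diff: "G_fun M y - G_fun M x = integral\<^sup>L M ?f"
    unfolding G_fun_eq by (rule Bochner_Integration.integral_diff[symmetric]) (rule integrable_G)+
  have "integral\<^sup>L M ?f \<noteq> 0"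
  proof
    assume "integral\<^sup>L M ?f = 0"
    then have "AE z in M. ?f z = 0"
      using integral_nonneg_eq_0_iff_AE[OF int] nn by auto
    then have "AE z in M. z \<notin> ?U"
    proof eventually_elim
      case (elim z)
      show ?case
      proof
        assume "z \<in> ?U"
        with sub(2) have "z \<in> btw y" "z \<notin> btw x" by auto
        \<comment> \<open>\<open>btw\<close> omits 0, so |z| is positive on the gap.\<close>
        with elim show False by (auto simp: btw_def)
      qed
    qed
    moreover have "open ?U"
      by (intro open_Collect_conj open_Collect_less continuous_intros)
    ultimately have "emeasure M ?U = 0"
      by (subst (asm) AE_iff_measurable[of ?U]) (auto simp: sets_M sets_eq_imp_space_eq[OF sets_M])
    moreover obtain q where q: "u < ereal q" "ereal q < v"
      using ereal_dense2[OF uv(2)] by auto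
    then have "q \<in> measure_support M"
      using uv by (auto simp: support)
    ultimately show False
      using \<open>open ?U\<close> q by (auto simp: measure_support_def)
  qed
  then show ?thesis
    using Bochner_Integration.integral_nonneg[of M ?f] nn diff by fastforce
qed

lemma G_strict_mono:
  assumes "0 \<le> x" "x < y" "y \<le> ap"
  shows "G_fun M x < G_fun M y"
proof -
  have "btw w = {z. 0 < z \<and> ereal z \<le> w}" if "0 \<le> w" for w
    using that by (cases w) (auto simp: btw_def)
  moreover have "0 < z" if "x < ereal z" for z
    using that assms(1) by (cases x) auto
  ultimately show ?thesis
    using assms am_neg by (intro G_less[of x y x y]) auto
qed

lemma G_strict_antimono:
  assumes "am \<le> x" "x < y" "y \<le> 0"
  shows "G_fun M y < G_fun M x"
proof -
  have "btw w = {z. z < 0 \<and> w \<le> ereal z}" if "w \<le> 0" for w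
    using that by (cases w) (auto simp: btw_def)
  moreover have "z < 0" if "ereal z < y" for z
    using that assms(3) by (cases y) auto
  ultimately show ?thesis
    using assms ap_pos by (intro G_less[of y x x y]) auto
qed


section \<open>Necessity: the reciprocating function as a matching of equal heights of
  \<open>G_fun\<close>\<close>

text \<open>The supremum is a maximum: past y, up to 0, the heights are strictly smaller.\<close>

lemma x_minus_G:
  assumes "am \<le> y" "y \<le> 0"
  shows "x_minus M (G_fun M y) = y"
  unfolding x_minus_def
proof (rule cSup_eq_maximum)
  fix x assume "x \<in> {x. x \<le> 0 \<and> G_fun M y \<le> G_fun M x}"
  then show "x \<le> y"
    using G_strict_antimono[of y x] assms by (auto simp flip: not_less)
qed (use assms in auto)

lemma x_plus_G:
  assumes "0 \<le> y" "y \<le> ap"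
  shows "x_plus M (G_fun M y) = y"
  unfolding x_plus_def
proof (rule cInf_eq_minimum)
  fix x assume "x \<in> {x. 0 \<le> x \<and> G_fun M y \<le> G_fun M x}"
  then show "y \<le> x"
    using G_strict_mono[of x y] assms by (auto simp flip: not_less)
qed (use assms in auto)

text \<open>Supplies the range for the intermediate value theorem on the opposite side of 0; by
  \<open>G_ends\<close> both sides have the same top value.\<close>

lemma G_bounds:
  assumes "am \<le> x" "x \<le> ap"
  shows "0 \<le> G_fun M x" "G_fun M x \<le> G_fun M ap"
proof -
  consider "x = 0" | "0 < x" | "x < 0" by fastforce
  then have "0 \<le> G_fun M x \<and> G_fun M x \<le> G_fun M ap"
  proof cases
    case 1
    then show ?thesis using G_strict_mono[of 0 ap] ap_pos by (simp add: G_fun_0)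
  next
    case 2
    then have "G_fun M x \<le> G_fun M ap"
      using G_strict_mono[of x ap] assms by (cases "x = ap") (auto simp: order_less_le)
    with 2 show ?thesis using G_strict_mono[of 0 x] assms by (simp add: G_fun_0)
  next
    case 3
    then have "G_fun M x \<le> G_fun M am"
      using G_strict_antimono[of am x] assms by (cases "x = am") (auto simp: order_less_le)
    with 3 show ?thesis using G_strict_antimono[of x 0] assms by (simp add: G_fun_0 G_ends)
  qed
  then show "0 \<le> G_fun M x" "G_fun M x \<le> G_fun M ap" by auto
qed

text \<open>Identifies a value of \<open>recip_fun\<close> from equal heights alone, without the
  extremum in its definition.\<close>

lemma recip_eqI:
  assumes "am \<le> x" "x \<le> ap" "am \<le> y" "y \<le> ap" "0 \<le> x \<and> y \<le> 0 \<or> x \<le> 0 \<and> 0 \<le> y"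
    and "G_fun M y = G_fun M x"
  shows "recip_fun M x = y"
proof (cases "0 \<le> x \<and> y \<le> 0")
  case True
  then show ?thesis using assms x_minus_G[of y] by (simp add: recip_fun_def)
next
  case False
  with assms have "x \<le> 0" "0 \<le> y" by auto
  then show ?thesis using assms x_plus_G[of y] by (simp add: recip_fun_nonpos)
qed

lemma recip_obtain:
  assumes "am \<le> x" "x \<le> ap"
  obtains y where "recip_fun M x = y" "G_fun M y = G_fun M x" "am \<le> y" "y \<le> ap"
    "0 \<le> x \<Longrightarrow> y \<le> 0" "x \<le> 0 \<Longrightarrow> 0 \<le> y"
proof (cases "0 \<le> x")
  case True
  obtain y where y: "am \<le> y" "y \<le> 0" "G_fun M y = G_fun M x"
    using IVT2'[of "G_fun M" 0 "G_fun M x" am] G_bounds[OF assms] am_neg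
      continuous_on_subset[OF continuous_G, of "{am..0}"] less_imp_le[OF am_neg]
    by (auto simp: G_fun_0 G_ends)
  \<comment> \<open>At x = 0 both sign conditions apply, so y must be 0.\<close>
  moreover have "y = 0" if "x = 0"
    using G_strict_antimono[of y 0] y that by (cases "y = 0") (auto simp: order_less_le)
  moreover have "recip_fun M x = y"
    using True y ap_pos assms by (intro recip_eqI) auto
  ultimately show ?thesis
    using True ap_pos by (intro that[of y]) auto
next
  case False
  obtain y where y: "0 \<le> y" "y \<le> ap" "G_fun M y = G_fun M x"
    using IVT'[of "G_fun M" 0 "G_fun M x" ap] G_bounds[OF assms]
      continuous_on_subset[OF continuous_G, of "{0..ap}"] less_imp_le[OF ap_pos]
    by (auto simp: G_fun_0)
  moreover have "recip_fun M x = y"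
    using False y am_neg assms by (intro recip_eqI) auto
  ultimately show ?thesis
    using False am_neg by (intro that[of y]) auto
qed

text \<open>Having equal heights on opposite sides of 0 is a symmetric relation.\<close>

lemma recip_recip:
  assumes "am \<le> x" "x \<le> ap"
  shows "recip_fun M (recip_fun M x) = x"
proof -
  obtain y where "recip_fun M x = y" "G_fun M y = G_fun M x" "am \<le> y" "y \<le> ap"
    "0 \<le> x \<Longrightarrow> y \<le> 0" "x \<le> 0 \<Longrightarrow> 0 \<le> y"
    using recip_obtain[OF assms] by metis
  moreover from this have "recip_fun M y = x"
    using assms linear[of 0 x] by (intro recip_eqI) auto
  ultimately show ?thesis by simp
qed

lemma recip_0: "recip_fun M 0 = 0"
  using am_neg ap_pos by (intro recip_eqI) auto

lemma recip_above:
  assumes "ap \<le> x"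
  shows "recip_fun M x = am"
proof -
  have "0 \<le> x" using ap_pos assms by auto
  then show ?thesis
    using x_minus_G[of am] am_neg G_above[OF assms] G_ends by (simp add: recip_fun_def)
qed

lemma recip_below:
  assumes "x \<le> am"
  shows "recip_fun M x = ap"
proof -
  have "x \<le> 0" using am_neg assms by auto
  then show ?thesis
    using x_plus_G[of ap] ap_pos G_below[OF assms] G_ends by (simp add: recip_fun_nonpos)
qed

lemma recip_strict_antimono: "strict_antimono_on {am..ap} (recip_fun M)"
proof (rule monotone_onI)
  fix x y assume "x \<in> {am..ap}" "y \<in> {am..ap}" and "x < y"
  then have xy: "am \<le> x" "x \<le> ap" "am \<le> y" "y \<le> ap" by auto
  obtain x' where x': "recip_fun M x = x'" "G_fun M x' = G_fun M x" "am \<le> x'" "x' \<le> ap"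
    "0 \<le> x \<Longrightarrow> x' \<le> 0" "x \<le> 0 \<Longrightarrow> 0 \<le> x'"
    using recip_obtain[OF xy(1,2)] by metis
  obtain y' where y': "recip_fun M y = y'" "G_fun M y' = G_fun M y" "am \<le> y'" "y' \<le> ap"
    "0 \<le> y \<Longrightarrow> y' \<le> 0" "y \<le> 0 \<Longrightarrow> 0 \<le> y'"
    using recip_obtain[OF xy(3,4)] by metis
  \<comment> \<open>The involution makes the function injective, so only the wrong strict order
    remains to be excluded.\<close>
  have "x' \<noteq> y'"
    using recip_recip[of x] recip_recip[of y] xy x' y' \<open>x < y\<close> by auto
  have "\<not> x' < y'"
  proof
    assume "x' < y'"
    consider "0 \<le> x" | "x \<le> 0" "0 \<le> y" | "y \<le> 0" by fastforce
    then show False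
    proof cases
      case 1
      then have "0 \<le> y" using \<open>x < y\<close> by simp
      have "G_fun M x < G_fun M y" using 1 \<open>x < y\<close> xy by (intro G_strict_mono)
      moreover have "G_fun M y' < G_fun M x'"
        using y'(5)[OF \<open>0 \<le> y\<close>] \<open>x' < y'\<close> x'(3) by (intro G_strict_antimono)
      ultimately show False using x'(2) y'(2) by simp
    next
      case 2
      then show False using \<open>x' < y'\<close> x'(6) y'(5) by simp
    next
      case 3
      then have "x \<le> 0" using \<open>x < y\<close> by simp
      have "G_fun M y < G_fun M x" using 3 \<open>x < y\<close> xy by (intro G_strict_antimono)
      moreover have "G_fun M x' < G_fun M y'"
        using x'(6)[OF \<open>x \<le> 0\<close>] \<open>x' < y'\<close> y'(4) by (intro G_strict_mono)
      ultimately show False using x'(2) y'(2) by simp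
    qed
  qed
  with \<open>x' \<noteq> y'\<close> show "recip_fun M y < recip_fun M x" using x' y' by auto
qed

lemma recip_range: "am \<le> recip_fun M x" "recip_fun M x \<le> ap"
proof -
  have "am \<le> recip_fun M x \<and> recip_fun M x \<le> ap"
  proof (cases "am \<le> x \<and> x \<le> ap")
    case True
    then show ?thesis using recip_obtain[of x] by metis
  next
    case False
    then show ?thesis using recip_above[of x] recip_below[of x] am_neg ap_pos by auto
  qed
  then show "am \<le> recip_fun M x" "recip_fun M x \<le> ap" by auto
qed

end

text \<open>Preimages of rays are rays: \<open>{y. a < r y} = {..<r a}\<close> for \<open>a\<close> in \<open>{am..<ap}\<close>.\<close>

lemma continuous_if_antimono_involution:
  fixes r :: "ereal \<Rightarrow> ereal"
  assumes range: "\<And>x. am \<le> r x" "\<And>x. r x \<le> ap"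
    and anti: "strict_antimono_on {am..ap} r"
    and below: "\<And>x. x \<le> am \<Longrightarrow> r x = ap" and above: "\<And>x. ap \<le> x \<Longrightarrow> r x = am"
    and invol: "\<And>x. am \<le> x \<Longrightarrow> x \<le> ap \<Longrightarrow> r (r x) = x"
  shows "continuous_on UNIV r"
proof -
  have less: "r y < r x" if "am \<le> x" "x < y" "y \<le> ap" for x y
    using monotone_onD[OF anti, of x y] that by auto
  have gt_iff: "a < r y \<longleftrightarrow> y < r a" if "am \<le> a" "a < ap" for a y
  proof -
    consider "y < am" | "am \<le> y" "y \<le> ap" | "ap < y" by fastforce
    then show ?thesis
    proof cases
      case 1
      then show ?thesis using below[of y] range(1)[of a] that by auto
    next
      case 2
      \<comment> \<open>As a = r (r a), comparing a with r y compares two values of r, and r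
        reverses order.\<close>
      then show ?thesis
        using less[of y "r a"] less[of "r a" y] less[of a "r y"] less[of "r y" a]
          invol[of a] invol[of y] range that by (metis less_imp_le not_less_iff_gr_or_eq)
    next
      case 3
      then show ?thesis using above[of y] range(2)[of a] that by auto
    qed
  qed
  have lt_iff: "r y < a \<longleftrightarrow> r a < y" if "am < a" "a \<le> ap" for a y
  proof -
    consider "y < am" | "am \<le> y" "y \<le> ap" | "ap < y" by fastforce
    then show ?thesis
    proof cases
      case 1
      then show ?thesis using below[of y] range(1)[of a] that by auto
    next
      case 2
      then show ?thesis
        using less[of y "r a"] less[of "r a" y] less[of a "r y"] less[of "r y" a]
          invol[of a] invol[of y] range that by (metis less_imp_le not_less_iff_gr_or_eq)
    next
      case 3
      then show ?thesis using above[of y] range(2)[of a] that by auto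
    qed
  qed
  have "(r \<longlongrightarrow> r x) (at x)" for x
  proof (rule order_tendstoI)
    fix a assume a: "a < r x"
    show "\<forall>\<^sub>F y in at x. a < r y"
    proof (cases "am \<le> a")
      case True
      with a have "a < ap" using range(2)[of x] by auto
      with a have "x < r a" by (simp only: gt_iff[OF True])
      then have "\<forall>\<^sub>F y in at x. y < r a" by (intro order_tendstoD(2)[OF tendsto_ident_at])
      then show ?thesis by (simp only: gt_iff[OF True \<open>a < ap\<close>])
    next
      case False
      then have "a < r y" for y using range(1)[of y] by auto
      then show ?thesis by simp
    qed
  next
    fix a assume a: "r x < a"
    show "\<forall>\<^sub>F y in at x. r y < a"
    proof (cases "a \<le> ap")
      case True
      with a have "am < a" using range(1)[of x] by auto
      with a have "r a < x" by (simp only: lt_iff[OF _ True])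
      then have "\<forall>\<^sub>F y in at x. r a < y" by (rule order_tendstoD(1)[OF tendsto_ident_at])
      then show ?thesis by (simp only: lt_iff[OF \<open>am < a\<close> True])
    next
      case False
      then have "r y < a" for y using range(2)[of y] by auto
      then show ?thesis by simp
    qed
  qed
  then show ?thesis by (simp add: continuous_on_def)
qed

section \<open>Lebesgue measure: open null sets and reflection\<close>

lemma open_AE_lborel_empty:
  fixes S :: "'a::euclidean_space set"
  assumes "open S" "AE x in lborel. x \<notin> S"
  shows "S = {}"
proof -
  have "S \<in> null_sets lborel"
    using assms by (subst (asm) AE_iff_null_sets[symmetric]) auto
  then have "negligible S"
    by (simp add: negligible_iff_null_sets null_sets_completionI)
  then show ?thesis using open_not_negligible[OF assms(1)] by auto
qed

lemma lborel_integral_reflect: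
  fixes f :: "real \<Rightarrow> real"
  shows "(LINT x|lborel. f (- x)) = (LINT x|lborel. f x)"
  using lborel_integral_real_affine[of "-1" f 0] by simp

section \<open>Sufficiency: order properties of r and the mixture built from it\<close>

locale reciprocating =
  fixes am ap :: ereal and r :: "ereal \<Rightarrow> ereal"
  assumes am_neg: "am < 0" and ap_pos: "0 < ap"
    and r_0: "r 0 = 0"
    and anti: "strict_antimono_on {am..ap} r"
    and cont: "continuous_on UNIV r"
    and below: "\<And>x. x \<le> am \<Longrightarrow> r x = ap" and above: "\<And>x. ap \<le> x \<Longrightarrow> r x = am"
    and invol: "\<And>x. am \<le> x \<Longrightarrow> x \<le> ap \<Longrightarrow> r (r x) = x"
begin

lemma r_less_iff:
  assumes "am \<le> x" "x \<le> ap" "am \<le> y" "y \<le> ap"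
  shows "r x < r y \<longleftrightarrow> y < x"
  using monotone_onD[OF anti, of x y] monotone_onD[OF anti, of y x] assms
  by (metis atLeastAtMost_iff not_less_iff_gr_or_eq)

lemma r_le_iff:
  assumes "am \<le> x" "x \<le> ap" "am \<le> y" "y \<le> ap"
  shows "r x \<le> r y \<longleftrightarrow> y \<le> x"
  using r_less_iff[OF assms(3,4,1,2)] by (simp flip: not_less)

lemma am_less: "0 \<le> z \<Longrightarrow> am < ereal z"
  using am_neg by (cases am) auto

lemma less_ap: "z \<le> 0 \<Longrightarrow> ereal z < ap"
  using ap_pos by (cases ap) auto

lemma r_pos: "am < x \<Longrightarrow> x < 0 \<Longrightarrow> 0 < r x \<and> r x < ap"
  using r_less_iff[of 0 x] r_less_iff[of x am] am_neg ap_pos below[of am] by (simp add: r_0)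

lemma r_neg: "0 < x \<Longrightarrow> x < ap \<Longrightarrow> am < r x \<and> r x < 0"
  using r_less_iff[of x 0] r_less_iff[of ap x] am_neg ap_pos above[of ap] by (simp add: r_0)

lemma r_measurable [measurable]: "r \<in> borel_measurable borel"
  by (rule borel_measurable_continuous_onI) (rule cont)

text \<open>A point \<open>z\<close> of \<open>D\<close> stands for one atom of the two-point law on \<open>{r t, t}\<close> with \<open>t = \<bar>z\<bar>\<close>: \<open>t\<close> if
  \<open>z > 0\<close> and \<open>r t\<close> if \<open>z < 0\<close>. This atom is \<open>h z\<close>, the other one is \<open>h (- z)\<close>, and \<open>g\<close> splits
  the weight \<open>E z = E (- z)\<close> between them. Since \<open>z\<close> and \<open>- z\<close> both carry \<open>E\<close>, its total mass is 2.\<close>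

definition h :: "real \<Rightarrow> real" where
  "h z = (if 0 \<le> z then z else real_of_ereal (r (ereal (- z))))"

text \<open>At 0 the two atoms would coincide and the denominator in \<open>g\<close> would
  vanish.\<close>

definition D :: "real set" where
  "D = {z. z \<noteq> 0 \<and> ereal \<bar>z\<bar> < ap}"

text \<open>The normal density serves as an even, strictly positive weight with finite first
  absolute moment.\<close>

definition E :: "real \<Rightarrow> real" where
  "E z = 2 * (indicator D z * std_normal_density z) /
    (LINT x|lborel. indicator D x * std_normal_density x)"

text \<open>In a centred two-point law each atom has mass proportional to the absolute value of the
  other atom.\<close>

definition g :: "real \<Rightarrow> real" where
  "g z = E z * (\<bar>h (- z)\<bar> / (\<bar>h z\<bar> + \<bar>h (- z)\<bar>))"

definition M :: "real measure" where
  "M = distr (density lborel (\<lambda>z. ennreal (g z))) borel h"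

lemma h_measurable [measurable]: "h \<in> borel_measurable borel"
  unfolding h_def by measurable

lemma D_measurable [measurable]: "D \<in> sets borel"
  unfolding D_def by measurable

lemma E_measurable [measurable]: "E \<in> borel_measurable borel"
  unfolding E_def by measurable

lemma g_measurable [measurable]: "g \<in> borel_measurable borel"
  unfolding g_def by measurable

lemma h_pos: "0 < z \<Longrightarrow> h z = z"
  by (simp add: h_def)

text \<open>On this range r lies strictly between \<open>am\<close> and 0, hence is finite, and
  \<open>real_of_ereal\<close> loses nothing.\<close>

lemma h_neg:
  assumes "z \<in> D" "0 < z"
  shows "ereal (h (- z)) = r (ereal z)" "h (- z) < 0"
proof -
  have "am < r (ereal z)" "r (ereal z) < 0"
    using assms r_neg[of "ereal z"] by (auto simp: D_def)
  then obtain t where "r (ereal z) = ereal t" "t < 0"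
    by (cases "r (ereal z)") auto
  then show "ereal (h (- z)) = r (ereal z)" "h (- z) < 0"
    using assms by (simp_all add: h_def)
qed

lemma D_minus: "- z \<in> D \<longleftrightarrow> z \<in> D"
  by (simp add: D_def)

lemma h_cases:
  assumes "z \<in> D"
  obtains "0 < z" "h z = z" "h (- z) < 0" | "z < 0" "h z < 0" "h (- z) = - z"
proof (cases "0 < z")
  case True
  then show ?thesis using assms by (intro that(1)) (simp_all add: h_pos h_neg)
next
  case False
  then have "z < 0" using assms by (auto simp: D_def)
  then show ?thesis
    using assms h_neg(2)[of "- z"] by (intro that(2)) (simp_all add: h_pos D_minus)
qed

section \<open>Sufficiency: normalisation and balance of the weights\<close>

lemma integrable_weight: "integrable lborel (\<lambda>z. indicator D z * std_normal_density z)"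
  using integrable_mult_indicator[of D lborel std_normal_density] integrable_std_normal_moment[of 0]
  by simp

text \<open>\<open>D\<close> contains the nonempty open interval from 0 to \<open>ap\<close>, where
  the density is positive. This permits dividing by the integral in \<open>E\<close>.\<close>

lemma weight_pos: "0 < (LINT z|lborel. indicator D z * std_normal_density z)" (is "0 < ?C")
proof -
  have "?C \<noteq> 0"
  proof
    assume "?C = 0"
    then have "AE z in lborel. indicator D z * std_normal_density z = 0"
      by (subst (asm) integral_nonneg_eq_0_iff_AE[OF integrable_weight])
        (auto simp: std_normal_density_def)
    then have "AE z in lborel. z \<notin> {z. 0 < z \<and> ereal z < ap}"
      by eventually_elim (auto simp: D_def std_normal_density_def)
    then have "{z::real. 0 < z \<and> ereal z < ap} = {}"
      by (intro open_AE_lborel_empty open_Collect_conj open_Collect_less continuous_intros)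
    moreover obtain q where "0 < ereal q" "ereal q < ap"
      using ereal_dense2[OF ap_pos] by auto
    ultimately show False by auto
  qed
  moreover have "0 \<le> ?C"
    by (rule Bochner_Integration.integral_nonneg) (simp add: std_normal_density_def)
  ultimately show ?thesis by linarith
qed

lemma E_nonneg: "0 \<le> E z"
  using weight_pos by (simp add: E_def std_normal_density_def)

lemma E_eq_0_iff: "E z = 0 \<longleftrightarrow> z \<notin> D"
  using weight_pos by (auto simp: E_def std_normal_density_def indicator_def)

lemma E_minus: "E (- z) = E z"
  by (simp add: E_def D_minus std_normal_density_def indicator_def)

lemma integrable_E: "integrable lborel E"
  unfolding E_def using integrable_weight by simp

lemma integral_E: "(LINT z|lborel. E z) = 2"
  unfolding E_def using weight_pos by simp

lemma integrable_E_abs: "integrable lborel (\<lambda>z. E z * \<bar>z\<bar>)"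
proof (rule Bochner_Integration.integrable_bound)
  let ?C = "LINT z|lborel. indicator D z * std_normal_density z"
  show "integrable lborel (\<lambda>z. 2 / ?C * (std_normal_density z * \<bar>z\<bar> ^ 1))"
    using integrable_std_normal_moment_abs[of 1] by (intro integrable_mult_right)
  show "AE z in lborel. norm (E z * \<bar>z\<bar>) \<le> norm (2 / ?C * (std_normal_density z * \<bar>z\<bar> ^ 1))"
    using weight_pos by (intro AE_I2) (auto simp: E_def indicator_def)
qed measurable

lemma g_nonneg: "0 \<le> g z"
  by (simp add: g_def E_nonneg)

lemma g_add_reflect: "g z + g (- z) = E z"
proof (cases "z \<in> D")
  case True
  then have "\<bar>h z\<bar> + \<bar>h (- z)\<bar> \<noteq> 0" by (auto elim!: h_cases)
  then show ?thesis
    by (simp add: g_def E_minus add.commute flip: distrib_left add_divide_distrib)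
next
  case False
  then show ?thesis by (simp add: g_def E_minus E_eq_0_iff[THEN iffD2])
qed

lemma g_eq_0_iff: "g z = 0 \<longleftrightarrow> z \<notin> D"
  by (auto simp: g_def E_eq_0_iff elim!: h_cases)

lemma integrable_g: "integrable lborel g"
  by (rule Bochner_Integration.integrable_bound[OF integrable_E])
    (auto intro!: AE_I2 simp: g_nonneg E_nonneg simp flip: g_add_reflect)

text \<open>Reflection preserves Lebesgue measure, so \<open>g\<close> and its reflection each carry
  half of the mass 2 of \<open>E\<close>.\<close>

lemma integral_g: "(LINT z|lborel. g z) = 1"
proof -
  have "integrable lborel (\<lambda>z. g (- z))"
    using lborel_integrable_real_affine[OF integrable_g, of "-1" 0] by simp
  then have "(LINT z|lborel. E z) = (LINT z|lborel. g z) + (LINT z|lborel. g (- z))"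
    using integrable_g by (simp flip: g_add_reflect)
  then show ?thesis by (simp add: lborel_integral_reflect integral_E)
qed

text \<open>Both sides are \<open>E z\<close> times the product of the two absolute values over
  their sum. This balance of the two atoms yields the zero mean and the equality of heights.\<close>

lemma g_abs_h_reflect: "g (- z) * \<bar>h (- z)\<bar> = g z * \<bar>h z\<bar>"
  by (simp add: g_def E_minus add.commute mult.commute)

lemma g_h_odd: "g (- z) * h (- z) = - (g z * h z)"
proof (cases "z \<in> D")
  case True
  then show ?thesis
    using g_abs_h_reflect[of z] by (cases rule: h_cases) (auto simp: abs_if)
next
  case False
  then show ?thesis using g_eq_0_iff[of z] g_eq_0_iff[of "- z"] by (simp add: D_minus)
qed

text \<open>The atom r t may be far larger than t, but by the balance its weighted size equals that
  of the atom t, which the normal moment controls.\<close>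

lemma g_h_bound: "g z * \<bar>h z\<bar> \<le> E z * \<bar>z\<bar>"
proof (cases "z \<in> D")
  case True
  have *: "g z * \<bar>h z\<bar> \<le> E z * \<bar>h z\<bar>" for z
    using g_add_reflect[of z] g_nonneg[of "- z"] by (intro mult_right_mono) auto
  from True show ?thesis
  proof (cases rule: h_cases)
    case 1
    then show ?thesis using *[of z] by simp
  next
    case 2
    have "g z * \<bar>h z\<bar> \<le> E z * \<bar>h (- z)\<bar>"
      using *[of "- z"] by (simp only: g_abs_h_reflect E_minus)
    with 2 show ?thesis by simp
  qed
next
  case False
  then show ?thesis using g_eq_0_iff[of z] by (simp add: E_nonneg)
qed

section \<open>Sufficiency: null sets, mean and support of the mixture\<close>

lemma sets_M: "sets M = sets borel"
  by (simp add: M_def)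

lemma integral_M:
  fixes f :: "real \<Rightarrow> real"
  assumes [measurable]: "f \<in> borel_measurable borel"
  shows "(LINT x|M. f x) = (LINT z|lborel. g z * f (h z))"
  unfolding M_def by (simp add: integral_distr integral_density g_nonneg)

text \<open>The density \<open>g\<close> is positive exactly on \<open>D\<close>, so null sets of
  \<open>M\<close> are read off from Lebesgue null sets of parameters.\<close>

lemma null_M_iff:
  assumes [measurable]: "A \<in> sets borel"
  shows "emeasure M A = 0 \<longleftrightarrow> (AE z in lborel. z \<in> D \<longrightarrow> h z \<notin> A)"
proof -
  have "emeasure M A = emeasure (density lborel (\<lambda>z. ennreal (g z))) (h -` A)"
    by (simp add: M_def emeasure_distr)
  moreover have "h -` A \<in> sets lborel"
    using measurable_sets[OF h_measurable assms] by simp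
  moreover have "ennreal (g z) = 0 \<longleftrightarrow> z \<notin> D" for z
    using g_nonneg[of z] by (simp add: g_eq_0_iff ennreal_eq_0_iff order_antisym_conv)
  ultimately have "emeasure M A = 0 \<longleftrightarrow> (AE z in lborel. z \<in> h -` A \<longrightarrow> z \<notin> D)"
    using null_sets_density_iff[of "\<lambda>z. ennreal (g z)" lborel "h -` A"] by (simp add: null_sets_def)
  also have "\<dots> \<longleftrightarrow> (AE z in lborel. z \<in> D \<longrightarrow> h z \<notin> A)"
    by (intro AE_cong) auto
  finally show ?thesis .
qed

lemma prob_space_M: "prob_space M"
proof -
  have "(\<integral>\<^sup>+ z. ennreal (g z) \<partial>lborel) = 1"
    using nn_integral_eq_integral[OF integrable_g] by (simp add: g_nonneg integral_g)
  then have "prob_space (density lborel (\<lambda>z. ennreal (g z)))"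
    by (intro prob_spaceI) (simp add: emeasure_density)
  then show ?thesis
    unfolding M_def by (rule prob_space.prob_space_distr) simp
qed

lemma null_singleton_M: "emeasure M {x} = 0"
proof -
  have "AE z in lborel. z \<in> D \<longrightarrow> h z \<notin> {x}"
    \<comment> \<open>Within \<open>D\<close>, \<open>h\<close> can take the value x only at x
      itself and, by the involution, at minus r x.\<close>
    using AE_lborel_singleton[of x] AE_lborel_singleton[of "- real_of_ereal (r (ereal x))"]
  proof eventually_elim
    case (elim z)
    have "z = - real_of_ereal (r (ereal x))" if "z \<in> D" "z < 0" "h z = x"
    proof -
      have "r (ereal x) = r (r (ereal (- z)))"
        using h_neg(1)[of "- z"] that by (simp add: D_minus)
      also have "\<dots> = ereal (- z)"
        using that am_less[of "- z"] by (intro invol) (auto simp: D_def)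
      finally show ?thesis by simp
    qed
    moreover have "h z = z" if "z \<in> D" "\<not> z < 0"
      using that by (intro h_pos) (auto simp: D_def)
    ultimately show ?case using elim by fastforce
  qed
  then show ?thesis by (simp add: null_M_iff)
qed

text \<open>The integrand \<open>g z * h z\<close> is odd, so its integral equals its own
  negative.\<close>

lemma zero_mean_M: "zero_mean M"
proof -
  have "integrable lborel (\<lambda>z. g z * h z)"
    by (rule Bochner_Integration.integrable_bound[OF integrable_E_abs])
      (auto intro!: AE_I2 simp: abs_mult g_nonneg E_nonneg g_h_bound)
  then have "integrable M (\<lambda>x. x)"
    unfolding M_def by (simp add: integrable_distr_eq integrable_density g_nonneg)
  moreover have "(LINT x|M. x) = (LINT z|lborel. g z * h z)"
    by (rule integral_M) measurable
  moreover have "(LINT z|lborel. g z * h z) = 0"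
    using lborel_integral_reflect[of "\<lambda>z. g z * h z"] unfolding g_h_odd by simp
  ultimately show ?thesis
    unfolding zero_mean_def by argo
qed

lemma h_in:
  assumes "z \<in> D"
  shows "am \<le> ereal (h z)" "ereal (h z) \<le> ap"
proof -
  have "am \<le> ereal (h z) \<and> ereal (h z) \<le> ap"
  proof (cases "0 < z")
    case True
    then show ?thesis using assms am_less[of z] by (auto simp: h_pos D_def)
  next
    case False
    with assms have z: "0 < - z" "- z \<in> D" by (auto simp: D_def)
    then have "am < r (ereal (- z))"
      using r_neg[of "ereal (- z)"] by (auto simp: D_def)
    then show ?thesis
      using h_neg[OF z(2,1)] less_ap[of "h z"] by (simp add: less_imp_le)
  qed
  then show "am \<le> ereal (h z)" "ereal (h z) \<le> ap" by auto
qed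

text \<open>A small move towards 0, or away from it if x = 0, avoids 0 and both ends of the
  interval.\<close>

lemma support_inner_point:
  assumes "am \<le> ereal x" "ereal x \<le> ap" "open U" "x \<in> U"
  obtains y where "y \<in> U" "y \<noteq> 0" "am < ereal y" "ereal y < ap"
proof -
  obtain e where e: "e > 0" "\<And>y. dist y x < e \<Longrightarrow> y \<in> U"
    using assms(3,4) by (auto simp: open_dist)
  consider "x = 0" | "0 < x" | "x < 0" by fastforce
  then show ?thesis
  proof cases
    case 1
    obtain y where y: "0 < ereal y" "ereal y < min (ereal e) ap"
      using ereal_dense2[of 0 "min (ereal e) ap"] e(1) ap_pos by auto
    then have "y \<in> U" using 1 by (intro e(2)) (auto simp: dist_real_def)
    moreover have "am < ereal y" using y(1) by (intro am_less) simp
    ultimately show ?thesis using y by (intro that[of y]) auto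
  next
    case 2
    obtain y where y: "max 0 (x - e) < y" "y < x"
      using dense[of "max 0 (x - e)" x] 2 e(1) by auto
    then have "y \<in> U" by (intro e(2)) (auto simp: dist_real_def)
    moreover have "am < ereal y" using y(1) by (intro am_less) simp
    moreover have "ereal y < ap" using assms(2) y(2) by (cases ap) auto
    ultimately show ?thesis using y by (intro that[of y]) auto
  next
    case 3
    obtain y where y: "x < y" "y < min 0 (x + e)"
      using dense[of x "min 0 (x + e)"] 3 e(1) by auto
    then have "y \<in> U" by (intro e(2)) (auto simp: dist_real_def)
    moreover have "ereal y < ap" using y(2) by (intro less_ap) simp
    moreover have "am < ereal y" using assms(1) y(1) by (cases am) auto
    ultimately show ?thesis using y by (intro that[of y]) auto
  qed
qed

lemma support_M: "measure_support M = {x. am \<le> ereal x \<and> ereal x \<le> ap}" (is "_ = ?I")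
proof (intro equalityI subsetI)
  fix x assume x: "x \<in> measure_support M"
  show "x \<in> ?I"
  proof (rule ccontr)
    assume "x \<notin> ?I"
    have "open {x. ereal x < am \<or> ap < ereal x}"
      by (intro open_Collect_disj open_Collect_less continuous_intros)
    then have "open (- ?I)" by (simp add: Compl_eq not_le)
    then have "emeasure M (- ?I) > 0"
      using x \<open>x \<notin> ?I\<close> by (auto simp: measure_support_def)
    moreover have "emeasure M (- ?I) = 0"
      using \<open>open (- ?I)\<close> by (subst null_M_iff) (auto simp: h_in)
    ultimately show False by simp
  qed
next
  fix x assume "x \<in> ?I"
  show "x \<in> measure_support M"
    unfolding measure_support_def
  proof (intro CollectI allI impI)
    fix U :: "real set" assume U: "open U" "x \<in> U"
    obtain y where y: "y \<in> U" "y \<noteq> 0" "am < ereal y" "ereal y < ap"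
      using support_inner_point[of x U] \<open>x \<in> ?I\<close> U by auto
    show "emeasure M U > 0"
    proof (rule ccontr)
      assume "\<not> emeasure M U > 0"
      then have "emeasure M U = 0" by (simp add: zero_less_iff_neq_zero)
      then have AE: "AE z in lborel. z \<in> D \<longrightarrow> h z \<notin> U"
        using U by (subst (asm) null_M_iff) auto
      show False
      proof (cases "0 < y")
        case True
        let ?V = "{z. 0 < z \<and> ereal z < ap \<and> z \<in> U}"
        have "open ?V"
          using U by (intro open_Collect_conj open_Collect_less continuous_intros) auto
        moreover have "AE z in lborel. z \<notin> ?V"
          using AE by eventually_elim (auto simp: D_def h_pos)
        ultimately have "?V = {}" by (rule open_AE_lborel_empty)
        with True y show False by auto
      next
        case False
        \<comment> \<open>A negative y is approached by atoms r t. Keeping r extended-valued makes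
          the parameter map continuous and this set open.\<close>
        let ?V = "{z. z < 0 \<and> ereal (- z) < ap \<and> r (ereal (- z)) \<in> ereal ` U}"
        have "continuous_on UNIV (\<lambda>z. r (ereal (- z)))"
          by (rule continuous_on_compose2[OF cont]) (auto intro!: continuous_intros)
        then have "open ((\<lambda>z. r (ereal (- z))) -` (ereal ` U))"
          using U by (intro open_vimage open_ereal)
        then have "open ?V"
          by (intro open_Collect_conj open_Collect_less continuous_intros) (simp_all add: vimage_def)
        moreover have "AE z in lborel. z \<notin> ?V"
          using AE
        proof eventually_elim
          case (elim z)
          show ?case
            using elim h_neg(1)[of "- z"] by (auto simp: D_def)
        qed
        ultimately have "?V = {}" by (rule open_AE_lborel_empty)
        moreover have "0 < r (ereal y)" "r (ereal y) < ap"
          using False y r_pos[of "ereal y"] by auto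
        then obtain t where t: "r (ereal y) = ereal t" "0 < t" "ereal t < ap"
          by (cases "r (ereal y)") auto
        \<comment> \<open>By the involution, the parameter of the atom y is minus r y.\<close>
        moreover have "r (ereal t) = ereal y"
          using invol[of "ereal y"] y t(1) by simp
        ultimately have "- t \<in> ?V" using y by auto
        with \<open>?V = {}\<close> show False by blast
      qed
    qed
  qed
qed

section \<open>Sufficiency: the reciprocating function of the mixture is r\<close>

text \<open>The substitution of - z for z swaps the two atoms of each law. Their contributions
  balance, and as r reverses order, t is at most x exactly when r t is at least r x.\<close>

lemma G_r:
  assumes "0 \<le> x" "x \<le> ap"
  shows "G_fun M (r x) = G_fun M x"
proof -
  have "am \<le> x" using am_neg assms(1) by simp
  have rx: "r x \<le> 0" using r_le_iff[of x 0] assms am_neg ap_pos by (simp add: r_0)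
  have eq: "G_fun M y = (LINT z|lborel. g z * (indicator (btw y) (h z) * \<bar>h z\<bar>))" for y
    unfolding G_fun_eq by (subst integral_M) auto
  have "G_fun M (r x) = (LINT z|lborel. g (- z) * (indicator (btw (r x)) (h (- z)) * \<bar>h (- z)\<bar>))"
    unfolding eq by (rule lborel_integral_reflect[symmetric])
  also have "\<dots> = (LINT z|lborel. g z * (indicator (btw x) (h z) * \<bar>h z\<bar>))"
  proof (rule Bochner_Integration.integral_cong)
    fix z
    show "g (- z) * (indicator (btw (r x)) (h (- z)) * \<bar>h (- z)\<bar>) = g z * (indicator (btw x) (h z) * \<bar>h z\<bar>)"
    proof (cases "z \<in> D")
      case True
      then have "h (- z) \<in> btw (r x) \<longleftrightarrow> h z \<in> btw x"
      proof (cases rule: h_cases)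
        case 1
        then have "am \<le> ereal z" "ereal z \<le> ap"
          using True h_in[of z] by auto
        then have "r x \<le> r (ereal z) \<longleftrightarrow> ereal z \<le> x"
          using assms \<open>am \<le> x\<close> by (intro r_le_iff)
        then show ?thesis
          using 1 h_neg(1)[OF True] by (simp add: btw_def)
      next
        case 2
        \<comment> \<open>Both memberships fail: each atom lies on the side of 0 opposite to its
          interval.\<close>
        have "\<not> x \<le> ereal (h z)" using 2(2) assms(1) by (cases x) auto
        moreover have "\<not> ereal (h (- z)) \<le> r x" using 2 rx by (cases "r x") auto
        ultimately show ?thesis using 2 by (simp add: btw_def)
      qed
      then show ?thesis using g_abs_h_reflect[of z] by (simp add: indicator_def)
    next
      case False
      then show ?thesis using g_eq_0_iff[of z] g_eq_0_iff[of "- z"] by (simp add: D_minus)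
    qed
  qed simp
  also have "\<dots> = G_fun M x" by (simp add: eq)
  finally show ?thesis .
qed

lemma centred_measure_M: "centred_measure M am ap"
  by (intro centred_measure.intro prob_space_M centred_measure_axioms.intro
      am_neg ap_pos sets_M null_singleton_M zero_mean_M support_M)

lemma recip_fun_M: "recip_fun M = r"
proof
  interpret centred_measure M am ap by (rule centred_measure_M)
  fix x
  consider "x \<le> am" | "ap \<le> x" | "am \<le> x" "x \<le> 0" | "0 \<le> x" "x \<le> ap" by fastforce
  then show "recip_fun M x = r x"
  proof cases
    case 1
    then show ?thesis by (simp add: recip_below below)
  next
    case 2
    then show ?thesis by (simp add: recip_above above)
  next
    case 3
    then have "x \<le> ap" using ap_pos by simp
    with 3 have "0 \<le> r x" "r x \<le> ap"
      using r_le_iff[of 0 x] r_le_iff[of x am] below[of am] am_neg ap_pos by (simp_all add: r_0)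
    with 3 \<open>x \<le> ap\<close> show ?thesis
      \<comment> \<open>For x on the negative side the equality of heights is applied at r x, whose
        image is x again.\<close>
      using G_r[of "r x"] invol[of x] am_neg by (intro recip_eqI) auto
  next
    case 4
    then have "am \<le> x" using am_neg by simp
    with 4 have "r x \<le> 0" "am \<le> r x"
      using r_le_iff[of x 0] r_le_iff[of ap x] above[of ap] am_neg ap_pos by (simp_all add: r_0)
    with 4 \<open>am \<le> x\<close> show ?thesis
      using G_r[of x] ap_pos by (intro recip_eqI) auto
  qed
qed

end

theorem proposition3p35:
  fixes am ap :: ereal and r :: "ereal \<Rightarrow> ereal"
  assumes "- \<infinity> \<le> am" and "am < 0" and "0 < ap" and "ap \<le> \<infinity>"
  shows "(\<exists>M :: real measure. prob_space M \<and> sets M = sets borel \<and> nonatomic M \<and> zero_mean M \<and>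
            measure_support M = {x. am \<le> ereal x \<and> ereal x \<le> ap} \<and> recip_fun M = r)
     \<longleftrightarrow> (r 0 = 0 \<and>
          strict_antimono_on {am..ap} r \<and>
          continuous_on UNIV r \<and>
          (\<forall>x\<in>{- \<infinity>..am}. r x = ap) \<and> (\<forall>x\<in>{ap..\<infinity>}. r x = am) \<and>
          (\<forall>x\<in>{am..ap}. r (r x) = x))"
    (is "?I \<longleftrightarrow> ?II")
proof
  assume ?I
  then obtain M where M: "prob_space M" "sets M = sets borel" "nonatomic M" "zero_mean M"
    "measure_support M = {x. am \<le> ereal x \<and> ereal x \<le> ap}" and r: "recip_fun M = r"
    by auto
  have "centred_measure M am ap"
    using M assms null_singleton_if_nonatomic[OF M(2,3)]
    by (intro centred_measure.intro centred_measure_axioms.intro)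
  then interpret centred_measure M am ap .
  \<comment> \<open>Continuity follows from the range, order and involution properties already
    shown.\<close>
  have "continuous_on UNIV (recip_fun M)"
    by (rule continuous_if_antimono_involution[OF recip_range recip_strict_antimono
          recip_below recip_above recip_recip])
  then show ?II
    using recip_0 recip_strict_antimono recip_below recip_above recip_recip unfolding r by auto
next
  assume II: ?II
  then interpret reciprocating am ap r
    using assms by unfold_locales auto
  have "finite_measure M" by (rule prob_space.finite_measure[OF prob_space_M])
  then have "nonatomic M"
    by (rule nonatomic_if_null_singletons[OF _ sets_M null_singleton_M])
  then show ?I
    using prob_space_M sets_M zero_mean_M support_M recip_fun_M by auto
qed

end
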